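(* Let $G$ and $H$ be connected graphs. Then \[ \pi(G \mathbin{\square} H) \leq 2\, \pi(G)\, \pi(H). \]
   Context: All graphs are finite, simple, and have at least one vertex. A configuration on a connected graph $F$ is a placement of pebbles on its vertices (a function $V(F)\to\mathbb{Z}_{\ge 0}$); its size is the total number of pebbles. A pebbling move removes two pebbles from a vertex $u$ carrying at least two pebbles and places one pebble on a vertex adjacent to $u$. Given a root vertex $r$, a configuration is $r$-solvable if, after some finite (possibly empty) sequence of pebbling moves, there is at least one pebble on $r$. The pebbling number $\pi(F)$ is the least number $n$ such that, for every root $r\in V(F)$, every configuration of size $n$ is $r$-solvable. The box (cartesian) product $G \mathbin{\square} H$ is the graph with vertex set $V(G)\times V(H)$ in which $(g,h)$ and $(g',h')$ are adjacent exactly when ($g=g'$ and $h,h'$ are adjacent in $H$) or ($h=h'$ and $g,g'$ are adjacent in $G$). *)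

theory Defs
  imports "Graph_Theory.Digraph_Component"
begin

text \<open>
  A finite simple graph is a \<^term>\<open>G :: 'a pair_pre_digraph\<close> with \<^prop>\<open>pair_graph G\<close>:
  each undirected edge is represented by its two (loop-free) orientations in \<^term>\<open>parcs G\<close>.
  The library's \<^const>\<open>Digraph_Component.connected\<close> includes that the vertex set is nonempty.
\<close>

definition box_product ::
    "'a pair_pre_digraph \<Rightarrow> 'b pair_pre_digraph \<Rightarrow> ('a \<times> 'b) pair_pre_digraph" where
  "box_product G H =
    \<lparr> pverts = pverts G \<times> pverts H,
      parcs = {((g, h), (g', h')) | g h g' h'.
        (g = g' \<and> g \<in> pverts G \<and> (h, h') \<in> parcs H) \<or>
        (h = h' \<and> h \<in> pverts H \<and> (g, g') \<in> parcs G)} \<rparr>"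

text \<open>
  Configurations are functions on the whole vertex type, set to 0 outside the vertex set.
\<close>

definition configuration :: "'a pair_pre_digraph \<Rightarrow> ('a \<Rightarrow> nat) \<Rightarrow> bool" where
  "configuration F p \<longleftrightarrow> (\<forall>v. v \<notin> pverts F \<longrightarrow> p v = 0)"

definition config_size :: "'a pair_pre_digraph \<Rightarrow> ('a \<Rightarrow> nat) \<Rightarrow> nat" where
  "config_size F p = (\<Sum>v\<in>pverts F. p v)"

text \<open>
  The two updates below do not interfere, as \<^term>\<open>u \<noteq> v\<close> for every arc of a simple graph.
\<close>

inductive pebbling_move :: "'a pair_pre_digraph \<Rightarrow> ('a \<Rightarrow> nat) \<Rightarrow> ('a \<Rightarrow> nat) \<Rightarrow> bool"
  for F :: "'a pair_pre_digraph" where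
  "(u, v) \<in> parcs F \<Longrightarrow> 2 \<le> p u \<Longrightarrow> pebbling_move F p (p(u := p u - 2, v := p v + 1))"

definition solvable :: "'a pair_pre_digraph \<Rightarrow> 'a \<Rightarrow> ('a \<Rightarrow> nat) \<Rightarrow> bool" where
  "solvable F r p \<longleftrightarrow> (\<exists>q. (pebbling_move F)\<^sup>*\<^sup>* p q \<and> 1 \<le> q r)"

text \<open>
  The minimum exists whenever \<^term>\<open>F\<close> is a finite connected graph; otherwise the value is
  unspecified.
\<close>

definition pebbling_number :: "'a pair_pre_digraph \<Rightarrow> nat" where
  "pebbling_number F =
    (LEAST n. \<forall>r\<in>pverts F. \<forall>p. configuration F p \<and> config_size F p = n \<longrightarrow> solvable F r p)"

end

theory Submission
  imports Defs
begin

text \<open>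
  Write \<open>m\<close> for the number of vertices of \<open>G\<close>. The proof gives the sharper bound
  \<open>\<pi>(G \<box> H) \<le> (\<pi>(G) + m) \<pi>(H)\<close>; the theorem follows from it because
  \<open>m \<le> \<pi>(G)\<close>: one pebble on each vertex other than the root admits no move at all.

  Let \<open>(g\<^sub>0, h\<^sub>0)\<close> be the root, and let the copy \<open>{g} \<times> H\<close> of \<open>H\<close> carry \<open>a g\<close> pebbles.
  Split these into \<open>a g div \<pi>(H)\<close> groups of size \<open>\<pi>(H)\<close>; each group can send a pebble to
  \<open>(g, h\<^sub>0)\<close> without touching the others (\<open>moves_collect_at_root\<close>). Since rounding loses
  less than \<open>\<pi>(H)\<close> pebbles in each of the \<open>m\<close> copies, at least \<open>\<pi>(G)\<close> pebbles arrive in the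
  copy \<open>G \<times> {h\<^sub>0}\<close> of \<open>G\<close>, and from there one of them can be brought to \<open>(g\<^sub>0, h\<^sub>0)\<close>.

  Two kinds of locality are used throughout: moves inside a copy of a factor are moves in the
  product, and extra pebbles do not obstruct a sequence of moves. Both are instances of
  \<open>moves_transport\<close>. Finally, as the pebbling number is a least number, its defining
  property is available only once some number with that property is known to exist; that is
  where connectedness enters (\<open>ex_sufficient_size\<close>).
\<close>

section \<open>Transporting sequences of moves\<close>

text \<open>
  A sequence of moves can be replayed along an injective homomorphism \<open>f\<close>, starting from any
  configuration \<open>c\<close> that dominates the original one, since a move only ever needs enough
  pebbles. The change along \<open>f\<close> is exactly the original change, written additively to avoid
  truncated subtraction. With \<open>f = id\<close> this says that surplus pebbles are harmless; with \<open>f\<close>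
  the inclusion of a factor it lifts moves to a product.
\<close>

lemma moves_transport:
  fixes F :: "'a pair_pre_digraph" and K :: "'b pair_pre_digraph"
  assumes "inj f"
    and hom: "\<And>x y. (x, y) \<in> parcs F \<Longrightarrow> (f x, f y) \<in> parcs K"
    and moves: "(pebbling_move F)\<^sup>*\<^sup>* p q"
    and le: "\<And>x. p x \<le> c (f x)"
  shows "\<exists>c'. (pebbling_move K)\<^sup>*\<^sup>* c c' \<and> (\<forall>x. c' (f x) + p x = c (f x) + q x)
    \<and> (\<forall>w. w \<notin> range f \<longrightarrow> c' w = c w)"
  using moves
proof (induction rule: rtranclp_induct)
  case base
  then show ?case by auto
next
  case (step q q')
  then obtain c' where c': "(pebbling_move K)\<^sup>*\<^sup>* c c'"
    and bal: "\<And>x. c' (f x) + p x = c (f x) + q x"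
    and off: "\<And>w. w \<notin> range f \<Longrightarrow> c' w = c w" by blast
  from step.hyps(2) obtain u v where uv: "(u, v) \<in> parcs F" "2 \<le> q u"
    and q': "q' = q(u := q u - 2, v := q v + 1)"
    by (auto elim: pebbling_move.cases)
  have le': "q x \<le> c' (f x)" for x using bal[of x] le[of x] by simp
  let ?d = "c'(f u := c' (f u) - 2, f v := c' (f v) + 1)"
  have "pebbling_move K c' ?d"
    using hom[OF uv(1)] uv(2) le'[of u] by (intro pebbling_move.intros) auto
  with c' have "(pebbling_move K)\<^sup>*\<^sup>* c ?d" by simp
  moreover have "?d (f x) + p x = c (f x) + q' x" for x
    using bal[of x] uv(2) le'[of u] \<open>inj f\<close> by (auto simp: q' inj_eq)
  moreover have "?d w = c w" if "w \<notin> range f" for w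
    using off[OF that] that by auto
  ultimately show ?case by blast
qed

lemma solvable_transport:
  assumes "inj f" and "\<And>x y. (x, y) \<in> parcs F \<Longrightarrow> (f x, f y) \<in> parcs K"
    and "solvable F r p" and le: "\<And>x. p x \<le> c (f x)"
  shows "solvable K (f r) c"
proof -
  obtain q where "(pebbling_move F)\<^sup>*\<^sup>* p q" "1 \<le> q r"
    using assms(3) by (auto simp: solvable_def)
  with moves_transport[OF assms(1,2) this(1) le]
  obtain c' where "(pebbling_move K)\<^sup>*\<^sup>* c c'" "c' (f r) + p r = c (f r) + q r" by blast
  with \<open>1 \<le> q r\<close> le[of r] have "1 \<le> c' (f r)" by linarith
  with \<open>(pebbling_move K)\<^sup>*\<^sup>* c c'\<close> show ?thesis by (auto simp: solvable_def)
qed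

lemma solvable_moves:
  assumes "(pebbling_move F)\<^sup>*\<^sup>* p q" and "solvable F r q"
  shows "solvable F r p"
  using assms by (auto simp: solvable_def intro: rtranclp_trans)

section \<open>Sizes that guarantee solvability\<close>

lemma ex_subfunction_sum:
  fixes p :: "'a \<Rightarrow> nat"
  assumes "finite V" and "n \<le> sum p V"
  shows "\<exists>s. (\<forall>x. s x \<le> p x) \<and> (\<forall>x. x \<notin> V \<longrightarrow> s x = 0) \<and> sum s V = n"
  using assms
proof (induction V arbitrary: n rule: finite_induct)
  case empty
  then show ?case by (intro exI[of _ "\<lambda>_. 0"]) auto
next
  case (insert a V)
  have "n - min n (p a) \<le> sum p V" using insert by simp
  then obtain s where s: "\<forall>x. s x \<le> p x" "\<forall>x. x \<notin> V \<longrightarrow> s x = 0" "sum s V = n - min n (p a)"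
    using insert.IH by blast
  have "sum (s(a := min n (p a))) V = sum s V"
    using insert.hyps by (intro sum.cong) auto
  with insert.hyps s show ?case
    by (intro exI[of _ "s(a := min n (p a))"]) auto
qed

text \<open>
  The pebbling number is the least sufficient size; keeping the predicate separate makes it
  possible to speak of sufficient sizes before one is known to exist.
\<close>

definition sufficient_size :: "'a pair_pre_digraph \<Rightarrow> nat \<Rightarrow> bool" where
  "sufficient_size F n \<longleftrightarrow>
    (\<forall>r\<in>pverts F. \<forall>p. configuration F p \<and> config_size F p = n \<longrightarrow> solvable F r p)"

lemma pebbling_number_eq_Least: "pebbling_number F = (LEAST n. sufficient_size F n)"
  by (simp add: pebbling_number_def sufficient_size_def)

lemma sufficient_size_subconfiguration:
  assumes "sufficient_size F n" and "finite (pverts F)" and "r \<in> pverts F"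
    and "n \<le> config_size F p"
  shows "\<exists>s. (\<forall>x. s x \<le> p x) \<and> config_size F s = n \<and> solvable F r s"
proof -
  obtain s where "\<forall>x. s x \<le> p x" "\<forall>x. x \<notin> pverts F \<longrightarrow> s x = 0" "sum s (pverts F) = n"
    using ex_subfunction_sum[OF assms(2), of n p] assms(4) by (auto simp: config_size_def)
  with assms(1,3) show ?thesis
    unfolding sufficient_size_def configuration_def config_size_def by blast
qed

text \<open>
  Splitting \<open>k n\<close> pebbles into \<open>k\<close> groups of sufficient size \<open>n\<close> brings \<open>k\<close> pebbles to the
  root: the groups are solved one after another, each leaving the rest untouched.
\<close>

lemma moves_collect_at_root:
  assumes suff: "sufficient_size F n" and fin: "finite (pverts F)" and r: "r \<in> pverts F"
    and "k * n \<le> config_size F p"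
  shows "\<exists>q. (pebbling_move F)\<^sup>*\<^sup>* p q \<and> k \<le> q r"
  using assms(4)
proof (induction k arbitrary: p)
  case 0
  then show ?case by auto
next
  case (Suc k)
  then have "n \<le> config_size F p" by simp
  from sufficient_size_subconfiguration[OF suff fin r this]
  obtain s where s: "\<And>x. s x \<le> p x" "config_size F s = n" "solvable F r s" by blast
  let ?rest = "\<lambda>x. p x - s x"
  have "config_size F ?rest = config_size F p - n"
    using s(1,2) by (simp add: config_size_def sum_subtractf_nat)
  with Suc.prems have "k * n \<le> config_size F ?rest" by simp
  then obtain q where q: "(pebbling_move F)\<^sup>*\<^sup>* ?rest q" "k \<le> q r" using Suc.IH by blast
  \<comment> \<open>Clear the other groups first while this one waits, then solve it on top of the result.\<close>
  obtain c where c: "(pebbling_move F)\<^sup>*\<^sup>* p c" "\<And>x. c x + ?rest x = p x + q x"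
    using moves_transport[of id F F ?rest q p] q(1) by auto
  have cs: "c x = q x + s x" for x using c(2)[of x] s(1)[of x] by simp
  obtain t where t: "(pebbling_move F)\<^sup>*\<^sup>* s t" "1 \<le> t r"
    using s(3) by (auto simp: solvable_def)
  obtain d where d: "(pebbling_move F)\<^sup>*\<^sup>* c d" "\<And>x. d x + s x = c x + t x"
    using moves_transport[of id F F s t c] t(1) cs by auto
  have "Suc k \<le> d r" using d(2)[of r] cs[of r] q(2) t(2) by simp
  moreover have "(pebbling_move F)\<^sup>*\<^sup>* p d" using c(1) d(1) by (rule rtranclp_trans)
  ultimately show ?case by blast
qed

section \<open>Connected graphs have sufficient sizes\<close>

lemma moves_along_arc:
  assumes "(u, v) \<in> parcs F" and "u \<noteq> v" and "2 * j \<le> p u"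
  shows "\<exists>q. (pebbling_move F)\<^sup>*\<^sup>* p q \<and> j + p v \<le> q v"
  using assms(3)
proof (induction j arbitrary: p)
  case 0
  then show ?case by auto
next
  case (Suc j)
  let ?p = "p(u := p u - 2, v := p v + 1)"
  have "pebbling_move F p ?p" using Suc.prems assms(1) by (intro pebbling_move.intros) auto
  moreover have "2 * j \<le> ?p u" using Suc.prems assms(2) by simp
  then obtain q where "(pebbling_move F)\<^sup>*\<^sup>* ?p q" "j + ?p v \<le> q v" using Suc.IH by blast
  ultimately show ?case by (intro exI[of _ q]) (auto intro: converse_rtranclp_into_rtranclp)
qed

lemma ex_solvable_pile:
  assumes "pair_graph F" and "Digraph_Component.connected (with_proj F)"
    and "u \<in> pverts F" and "r \<in> pverts F"
  shows "\<exists>m. \<forall>p. m \<le> p u \<longrightarrow> solvable F r p"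
proof -
  interpret pair_graph F by fact
  have "u \<rightarrow>\<^sup>*\<^bsub>with_proj (mk_symmetric (with_proj F))\<^esub> r"
    using assms by (auto simp: Digraph_Component.connected_def strongly_connected_def)
  then have "u \<rightarrow>\<^sup>*\<^bsub>with_proj F\<^esub> r"
    using reachable_mk_symmetric_eq sym_arcs by simp
  then have "(u, r) \<in> (parcs F)\<^sup>*"
    by (auto simp: reachable_def dest: rtrancl_on_rtranclI)
  then show ?thesis
  proof (induction rule: converse_rtrancl_induct)
    case base
    then show ?case by (intro exI[of _ 1]) (auto simp: solvable_def)
  next
    case (step u v)
    then obtain m where m: "\<And>p. m \<le> p v \<Longrightarrow> solvable F r p" by blast
    have "u \<noteq> v" using pair_no_loops[OF step.hyps(1)] by simp
    have "solvable F r p" if pile: "2 * m \<le> p u" for p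
    proof -
      obtain q where q: "(pebbling_move F)\<^sup>*\<^sup>* p q" "m + p v \<le> q v"
        using moves_along_arc[OF step.hyps(1) \<open>u \<noteq> v\<close>, of m p] pile by blast
      then have "solvable F r q" by (intro m) simp
      with q(1) show ?thesis by (rule solvable_moves)
    qed
    then show ?case by blast
  qed
qed

text \<open>
  If \<open>m u r\<close> pebbles on \<open>u\<close> suffice to reach \<open>r\<close>, then a configuration with
  \<open>\<Sum>u. \<Sum>r. m u r\<close> pebbles has, by the pigeonhole principle, some vertex \<open>u\<close> carrying at
  least \<open>m u r\<close> of them for every \<open>r\<close>.
\<close>

lemma ex_sufficient_size:
  assumes "pair_graph F" and "Digraph_Component.connected (with_proj F)"
  shows "\<exists>n. sufficient_size F n"
proof -
  interpret pair_graph F by fact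
  let ?V = "pverts F"
  have fin: "finite ?V" by (rule pair_finite_verts)
  obtain m where m: "\<And>u r p. u \<in> ?V \<Longrightarrow> r \<in> ?V \<Longrightarrow> m u r \<le> p u \<Longrightarrow> solvable F r p"
    using ex_solvable_pile[OF assms] by metis
  have "solvable F r p"
    if r: "r \<in> ?V" and size: "config_size F p = (\<Sum>u\<in>?V. \<Sum>r\<in>?V. m u r)" for r p
  proof -
    have "\<exists>u\<in>?V. (\<Sum>r\<in>?V. m u r) \<le> p u"
    proof (rule ccontr)
      assume "\<not> ?thesis"
      then have "sum p ?V < (\<Sum>u\<in>?V. \<Sum>r\<in>?V. m u r)"
        using fin r by (intro sum_strict_mono) auto
      with size show False by (simp add: config_size_def)
    qed
    then obtain u where u: "u \<in> ?V" "(\<Sum>r\<in>?V. m u r) \<le> p u" by blast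
    have "m u r \<le> (\<Sum>r\<in>?V. m u r)" using fin r by (intro member_le_sum) auto
    with u r show ?thesis by (intro m) auto
  qed
  then show ?thesis unfolding sufficient_size_def by blast
qed

lemma pebbling_number_sufficient:
  assumes "pair_graph F" and "Digraph_Component.connected (with_proj F)"
  shows "sufficient_size F (pebbling_number F)"
  unfolding pebbling_number_eq_Least using ex_sufficient_size[OF assms] by (rule LeastI_ex)

text \<open>
  With fewer pebbles than vertices, put at most one pebble on each vertex and none on the
  root: no move is possible, so the root is never reached.
\<close>

lemma card_le_sufficient_size:
  assumes "sufficient_size F n" and fin: "finite (pverts F)"
  shows "card (pverts F) \<le> n"
proof (rule ccontr)
  assume less: "\<not> ?thesis"
  then obtain r where r: "r \<in> pverts F" by fastforce
  have "n \<le> card (pverts F - {r})" using less r fin by simp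
  then obtain S where S: "S \<subseteq> pverts F - {r}" "card S = n"
    by (meson obtain_subset_with_card_n)
  let ?p = "\<lambda>x. if x \<in> S then 1 else 0 :: nat"
  have "pverts F \<inter> {x. x \<in> S} = S" using S(1) by auto
  then have "config_size F ?p = n"
    using fin S(2) by (simp add: config_size_def sum.If_cases)
  moreover have "configuration F ?p" using S(1) by (auto simp: configuration_def)
  ultimately have "solvable F r ?p" using assms(1) r by (auto simp: sufficient_size_def)
  then obtain q where q: "(pebbling_move F)\<^sup>*\<^sup>* ?p q" "1 \<le> q r" by (auto simp: solvable_def)
  have stuck: "\<not> pebbling_move F ?p q'" for q'
    by (auto elim!: pebbling_move.cases split: if_splits)
  have "q = ?p" using q(1) stuck by (auto elim: converse_rtranclpE)
  with q(2) S(1) show False by (auto split: if_splits)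
qed

section \<open>Products\<close>

lemma pverts_box_product: "pverts (box_product G H) = pverts G \<times> pverts H"
  by (simp add: box_product_def)

lemma box_product_arc_right:
  "g \<in> pverts G \<Longrightarrow> (h, h') \<in> parcs H \<Longrightarrow> ((g, h), (g, h')) \<in> parcs (box_product G H)"
  by (simp add: box_product_def)

lemma box_product_arc_left:
  "h \<in> pverts H \<Longrightarrow> (g, g') \<in> parcs G \<Longrightarrow> ((g, h), (g', h)) \<in> parcs (box_product G H)"
  by (simp add: box_product_def)

text \<open>
  Copies of \<open>H\<close> over different vertices of \<open>G\<close> are disjoint, so they can be treated one after
  another, each still in its original state when its turn comes.
\<close>

lemma moves_collect_in_copies:
  assumes suff: "sufficient_size H n" and "n \<noteq> 0"
    and finH: "finite (pverts H)" and r: "r \<in> pverts H"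
    and "finite S" and "S \<subseteq> pverts G"
  shows "\<exists>c'. (pebbling_move (box_product G H))\<^sup>*\<^sup>* c c'
    \<and> (\<forall>g\<in>S. config_size H (\<lambda>h. c (g, h)) div n \<le> c' (g, r))
    \<and> (\<forall>g h. g \<notin> S \<longrightarrow> c' (g, h) = c (g, h))"
  using assms(5,6)
proof (induction S rule: finite_induct)
  case empty
  then show ?case by auto
next
  case (insert a S)
  then obtain c' where c': "(pebbling_move (box_product G H))\<^sup>*\<^sup>* c c'"
    and coll: "\<And>g. g \<in> S \<Longrightarrow> config_size H (\<lambda>h. c (g, h)) div n \<le> c' (g, r)"
    and rest: "\<And>g h. g \<notin> S \<Longrightarrow> c' (g, h) = c (g, h)" by auto
  let ?p = "\<lambda>h. c (a, h)"
  have "config_size H ?p div n * n \<le> config_size H ?p" by simp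
  from moves_collect_at_root[OF suff finH r this]
  obtain q where q: "(pebbling_move H)\<^sup>*\<^sup>* ?p q" "config_size H ?p div n \<le> q r" by blast
  have "\<exists>d. (pebbling_move (box_product G H))\<^sup>*\<^sup>* c' d
    \<and> (\<forall>h. d (a, h) + ?p h = c' (a, h) + q h)
    \<and> (\<forall>w. w \<notin> range (Pair a) \<longrightarrow> d w = c' w)"
    using insert rest[of a]
    by (intro moves_transport[OF _ _ q(1)]) (auto simp: inj_on_def box_product_arc_right)
  then obtain d where d: "(pebbling_move (box_product G H))\<^sup>*\<^sup>* c' d"
    and bal: "\<And>h. d (a, h) + ?p h = c' (a, h) + q h"
    and off: "\<And>w. w \<notin> range (Pair a) \<Longrightarrow> d w = c' w" by blast
  have "d (a, r) = q r" using bal[of r] rest[OF insert.hyps(2)] by simp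
  moreover have "d (g, h) = c' (g, h)" if "g \<noteq> a" for g h using that by (intro off) auto
  moreover have "(pebbling_move (box_product G H))\<^sup>*\<^sup>* c d" using c' d by (rule rtranclp_trans)
  ultimately show ?case using q(2) coll rest insert.hyps(2)
    by (intro exI[of _ d]) (metis insert_iff)
qed

lemma sum_div_lower_bound:
  fixes a :: "'a \<Rightarrow> nat"
  assumes "n \<noteq> 0" and "(k + card V) * n \<le> sum a V"
  shows "k \<le> (\<Sum>v\<in>V. a v div n)"
proof -
  have "sum a V = (\<Sum>v\<in>V. a v div n * n + a v mod n)" by simp
  also have "\<dots> \<le> (\<Sum>v\<in>V. a v div n * n + n)"
    using assms(1) by (intro sum_mono add_left_mono less_imp_le mod_less_divisor) simp
  also have "\<dots> = ((\<Sum>v\<in>V. a v div n) + card V) * n"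
    by (simp add: sum.distrib sum_distrib_right add_mult_distrib)
  finally have "(k + card V) * n \<le> ((\<Sum>v\<in>V. a v div n) + card V) * n"
    using assms(2) by (rule order_trans[rotated])
  with assms(1) show ?thesis by (simp add: mult_le_cancel2)
qed

text \<open>
  The surplus \<open>card (pverts G) * n\<close> in the size pays for what is lost to rounding in the copies
  of \<open>H\<close>, so that \<open>k\<close> pebbles survive in the copy of \<open>G\<close> through the root.
\<close>

lemma box_product_solvable:
  assumes finG: "finite (pverts G)" and finH: "finite (pverts H)"
    and suffG: "sufficient_size G k" and suffH: "sufficient_size H n"
    and size: "(k + card (pverts G)) * n \<le> config_size (box_product G H) c"
    and root: "g\<^sub>0 \<in> pverts G" "h\<^sub>0 \<in> pverts H"
  shows "solvable (box_product G H) (g\<^sub>0, h\<^sub>0) c"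
proof -
  let ?a = "\<lambda>g. config_size H (\<lambda>h. c (g, h))"
  have "card (pverts H) \<noteq> 0" using root(2) finH by auto
  with card_le_sufficient_size[OF suffH finH] have "n \<noteq> 0" by simp
  have "config_size (box_product G H) c = sum ?a (pverts G)"
    by (simp add: config_size_def pverts_box_product sum.cartesian_product)
  with size have "(k + card (pverts G)) * n \<le> sum ?a (pverts G)" by simp
  then have k: "k \<le> (\<Sum>g\<in>pverts G. ?a g div n)" by (rule sum_div_lower_bound[OF \<open>n \<noteq> 0\<close>])
  obtain c' where c': "(pebbling_move (box_product G H))\<^sup>*\<^sup>* c c'"
    and ge: "\<And>g. g \<in> pverts G \<Longrightarrow> ?a g div n \<le> c' (g, h\<^sub>0)"
    using moves_collect_in_copies[OF suffH \<open>n \<noteq> 0\<close> finH root(2) finG order_refl] by blast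
  have "(\<Sum>g\<in>pverts G. ?a g div n) \<le> config_size G (\<lambda>g. c' (g, h\<^sub>0))"
    unfolding config_size_def[of G] by (intro sum_mono ge)
  with k have "k \<le> config_size G (\<lambda>g. c' (g, h\<^sub>0))" by (rule order_trans)
  from sufficient_size_subconfiguration[OF suffG finG root(1) this]
  obtain s where s: "\<And>g. s g \<le> c' (g, h\<^sub>0)" "solvable G g\<^sub>0 s" by blast
  have "solvable (box_product G H) (g\<^sub>0, h\<^sub>0) c'"
    using s root(2)
    by (intro solvable_transport[where f = "\<lambda>g. (g, h\<^sub>0)", OF _ _ s(2)])
      (auto simp: inj_on_def box_product_arc_left)
  with c' show ?thesis by (rule solvable_moves)
qed

theorem theorem3p1:
  fixes G :: "'a pair_pre_digraph" and H :: "'b pair_pre_digraph"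
  assumes "pair_graph G" and "Digraph_Component.connected (with_proj G)"
    and "pair_graph H" and "Digraph_Component.connected (with_proj H)"
  shows "pebbling_number (box_product G H) \<le> 2 * pebbling_number G * pebbling_number H"
proof -
  interpret G: pair_graph G by fact
  interpret H: pair_graph H by fact
  let ?k = "pebbling_number G" and ?n = "pebbling_number H"
  have suff: "sufficient_size G ?k" "sufficient_size H ?n"
    using assms by (simp_all add: pebbling_number_sufficient)
  have "card (pverts G) \<le> ?k"
    using suff(1) G.pair_finite_verts by (rule card_le_sufficient_size)
  then have "(?k + card (pverts G)) * ?n \<le> 2 * ?k * ?n" by (intro mult_right_mono) auto
  then have "sufficient_size (box_product G H) (2 * ?k * ?n)"
    unfolding sufficient_size_def[of "box_product G H"] pverts_box_product
    using box_product_solvable[OF G.pair_finite_verts H.pair_finite_verts suff] by auto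
  then show ?thesis unfolding pebbling_number_eq_Least[of "box_product G H"] by (rule Least_le)
qed

end
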